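(* Let $A\in\mathbb{R}^{n\times n}$, and let $\mathcal{P}=\{x\in\mathbb{R}^n : Gx\le b\}$ be a polyhedron, where $G\in\mathbb{R}^{m\times n}$ and $b\in\mathbb{R}^m$. Assume that $\mathcal{P}$ is an invariant set for the continuous system $\dot{x}(t)=Ax(t)$. Then there exists $\hat\tau>0$ such that for every $x_k\in\mathcal{P}$ and every $\Delta t\in[0,\hat\tau]$, we have $x_{k+1}\in\mathcal{P}$, where $x_{k+1}=(I-\Delta t A)^{-1}x_k$ is obtained by the backward Euler method; i.e., $\mathcal{P}$ is an invariant set for the discrete system $x_{k+1}=(I-\Delta t A)^{-1}x_k$ for every such $\Delta t$.
   Context: The inequality $Gx\le b$ is componentwise. A set $\mathcal{S}$ is an invariant set for $\dot x(t)=Ax(t)$ if $x(0)\in\mathcal{S}$ implies $x(t)\in\mathcal{S}$ for all $t\ge0$. It is an invariant set for a discrete system $x_{k+1}=Mx_k$ if $x_k\in\mathcal{S}$ implies $x_{k+1}\in\mathcal{S}$ for all $k\in\mathbb{N}$. A statement about $x_{k+1}=(I-\Delta t A)^{-1}x_k$ is understood to include that $I-\Delta t A$ is nonsingular. *)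

theory Defs
  imports "HOL-Analysis.Analysis"
begin

text \<open>The order on \<^typ>\<open>real ^ 'm\<close> is the componentwise one.\<close>

definition polyhedron_of :: "real ^ 'n ^ 'm \<Rightarrow> real ^ 'm \<Rightarrow> (real ^ 'n) set" where
  "polyhedron_of G b = {x. G *v x \<le> b}"

text \<open>The derivative at \<open>t = 0\<close> is one-sided, since solutions live on \<open>[0, \<infinity>)\<close>.\<close>

definition solves_linear_ode :: "real ^ 'n ^ 'n \<Rightarrow> (real \<Rightarrow> real ^ 'n) \<Rightarrow> bool" where
  "solves_linear_ode A x \<longleftrightarrow>
     (\<forall>t\<ge>0. (x has_vector_derivative A *v x t) (at t within {0..}))"

definition invariant_continuous :: "real ^ 'n ^ 'n \<Rightarrow> (real ^ 'n) set \<Rightarrow> bool" where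
  "invariant_continuous A S \<longleftrightarrow>
     (\<forall>x. solves_linear_ode A x \<longrightarrow> x 0 \<in> S \<longrightarrow> (\<forall>t\<ge>0. x t \<in> S))"

definition invariant_discrete :: "real ^ 'n ^ 'n \<Rightarrow> (real ^ 'n) set \<Rightarrow> bool" where
  "invariant_discrete M S \<longleftrightarrow>
     (\<forall>x :: nat \<Rightarrow> real ^ 'n. (\<forall>k. x (Suc k) = M *v x k) \<longrightarrow>
        (\<forall>k. x k \<in> S \<longrightarrow> x (Suc k) \<in> S))"

end

theory Submission
  imports Defs
begin

text \<open>
  Formally \<open>(I - h A)\<^sup>-\<^sup>1 x = \<integral>\<^sub>0\<^sup>\<infinity> e\<^sup>-\<^sup>s e\<^bsup>s h A\<^esup> x ds\<close> as soon as \<open>h \<parallel>A\<parallel> < 1\<close>: a backward Euler step is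
  a weighted average of points on the exact trajectory through \<open>x\<close>. If the trajectory never leaves
  a closed half-space, neither does the average, and the bound on \<open>h\<close> involves only \<open>\<parallel>A\<parallel>\<close>. This is
  why one threshold serves every point of the polyhedron, bounded or not.

  The integral need not be formed. Let \<open>y\<close> be the trajectory starting at \<open>y\<^sub>0 = (I - h A)\<^sup>-\<^sup>1 x\<close>. Then
  \<open>y - h y'\<close> is the trajectory starting at \<open>x\<close>, so \<open>g \<bullet> (y - h y') \<le> \<beta>\<close> along it for each defining
  inequality \<open>g \<bullet> z \<le> \<beta>\<close> of the polyhedron. This says exactly that
  \<open>w t = e\<^bsup>- t / h\<^esup> (g \<bullet> y t - \<beta>)\<close> has derivative \<open>w' \<ge> 0\<close>. As \<open>y\<close> grows at most like \<open>e\<^bsup>\<parallel>A\<parallel> t\<^esup>\<close> and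
  \<open>\<parallel>A\<parallel> < 1 / h\<close>, the function \<open>w\<close> tends to \<open>0\<close>; increasing to the limit \<open>0\<close>, it satisfies
  \<open>w 0 \<le> 0\<close>, that is, \<open>g \<bullet> y\<^sub>0 \<le> \<beta>\<close> (\<open>resolvent_in_halfspace\<close>). The trajectory and its growth bound
  come from the exponential series (\<open>linear_flow_has_vector_derivative\<close>, \<open>norm_linear_flow_le\<close>).
\<close>

section \<open>The flow of a linear vector field\<close>

text \<open>This is \<open>e\<^bsup>t A\<^esup> v\<close>. Applying the series to a vector, instead of summing powers of \<open>A\<close>, allows
  the theory of scalar power series to be used on each coordinate.\<close>

definition linear_flow :: "real ^ 'n ^ 'n \<Rightarrow> real ^ 'n \<Rightarrow> real \<Rightarrow> real ^ 'n" where
  "linear_flow A v t = (\<Sum>n. (t ^ n / fact n) *\<^sub>R (((*v) A) ^^ n) v)"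

lemma norm_matrix_vector_funpow_le:
  fixes A :: "real ^ 'n ^ 'n"
  shows "norm ((((*v) A) ^^ n) v) \<le> onorm ((*v) A) ^ n * norm v"
proof (induction n)
  case 0
  then show ?case by simp
next
  case (Suc n)
  have "norm ((((*v) A) ^^ Suc n) v) \<le> onorm ((*v) A) * norm ((((*v) A) ^^ n) v)"
    using onorm[OF matrix_vector_mul_bounded_linear, of A "(((*v) A) ^^ n) v"] by simp
  also have "\<dots> \<le> onorm ((*v) A) * (onorm ((*v) A) ^ n * norm v)"
    by (intro mult_left_mono Suc.IH onorm_pos_le matrix_vector_mul_bounded_linear)
  finally show ?case by (simp add: mult.assoc)
qed

lemma linear_flow_term_le:
  fixes A :: "real ^ 'n ^ 'n"
  shows "norm ((t ^ n / fact n) *\<^sub>R (((*v) A) ^^ n) v)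
           \<le> ((onorm ((*v) A) * \<bar>t\<bar>) ^ n /\<^sub>R fact n) * norm v"
proof -
  have "norm ((t ^ n / fact n) *\<^sub>R (((*v) A) ^^ n) v)
          = \<bar>t\<bar> ^ n / fact n * norm ((((*v) A) ^^ n) v)"
    by (simp add: power_abs)
  also have "\<dots> \<le> \<bar>t\<bar> ^ n / fact n * (onorm ((*v) A) ^ n * norm v)"
    by (intro mult_left_mono norm_matrix_vector_funpow_le) simp
  finally show ?thesis by (simp add: power_mult_distrib field_simps)
qed

lemma
  fixes A :: "real ^ 'n ^ 'n"
  shows summable_linear_flow: "summable (\<lambda>n. (t ^ n / fact n) *\<^sub>R (((*v) A) ^^ n) v)"
    and norm_linear_flow_le: "norm (linear_flow A v t) \<le> exp (onorm ((*v) A) * \<bar>t\<bar>) * norm v"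
proof -
  have exp_sums: "(\<lambda>n. ((onorm ((*v) A) * \<bar>t\<bar>) ^ n /\<^sub>R fact n) * norm v)
                    sums (exp (onorm ((*v) A) * \<bar>t\<bar>) * norm v)"
    by (intro sums_mult2 exp_converges)
  have summable_norm: "summable (\<lambda>n. norm ((t ^ n / fact n) *\<^sub>R (((*v) A) ^^ n) v))"
    by (rule summable_norm_comparison_test[OF _ sums_summable[OF exp_sums]])
       (use linear_flow_term_le in blast)
  then show "summable (\<lambda>n. (t ^ n / fact n) *\<^sub>R (((*v) A) ^^ n) v)"
    by (rule summable_norm_cancel)
  have "norm (linear_flow A v t) \<le> (\<Sum>n. norm ((t ^ n / fact n) *\<^sub>R (((*v) A) ^^ n) v))"
    unfolding linear_flow_def by (rule Series.summable_norm[OF summable_norm])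
  also have "\<dots> \<le> exp (onorm ((*v) A) * \<bar>t\<bar>) * norm v"
    using suminf_le[OF linear_flow_term_le summable_norm sums_summable[OF exp_sums]]
    by (simp add: sums_unique[OF exp_sums])
  finally show "norm (linear_flow A v t) \<le> exp (onorm ((*v) A) * \<bar>t\<bar>) * norm v" .
qed

lemma linear_flow_0 [simp]: "linear_flow A v 0 = v"
proof -
  have "(\<lambda>n. (0 ^ n / fact n) *\<^sub>R (((*v) A) ^^ n) v) sums ((0 ^ 0 / fact 0) *\<^sub>R (((*v) A) ^^ 0) v)"
    by (rule sums_single[where i = 0, THEN sums_cong[THEN iffD1, rotated]]) auto
  then show ?thesis
    by (simp add: linear_flow_def sums_iff)
qed

text \<open>Paired with a fixed vector \<open>u\<close>, the flow is a real power series that converges everywhere; its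
  termwise derivative shifts \<open>A\<^sup>n v\<close> to \<open>A\<^sup>n\<^sup>+\<^sup>1 v\<close>, which is one application of \<open>A\<close>.\<close>

lemma linear_flow_has_vector_derivative:
  "(linear_flow A v has_vector_derivative A *v linear_flow A v t) (at t within S)"
proof -
  have "((\<lambda>s. linear_flow A v s \<bullet> u) has_real_derivative (A *v linear_flow A v t) \<bullet> u) (at t)"
    for u
  proof -
    define c where "c = (\<lambda>n. ((((*v) A) ^^ n) v \<bullet> u) / fact n)"
    have inner_summable: "summable (\<lambda>n. c n * s ^ n)" for s
      using bounded_linear.summable[OF bounded_linear_inner_left summable_linear_flow, of s A v u]
      by (simp add: c_def mult.commute)
    have inner_flow: "linear_flow A v s \<bullet> u = (\<Sum>n. c n * s ^ n)" for s
      unfolding linear_flow_def c_def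
      using bounded_linear.suminf[OF bounded_linear_inner_left summable_linear_flow, of s A v u]
      by (simp add: mult.commute)
    have "bounded_linear (\<lambda>x. (A *v x) \<bullet> u)"
      by (intro bounded_linear_inner_left_comp matrix_vector_mul_bounded_linear)
    from bounded_linear.suminf[OF this summable_linear_flow, of t A v]
    have "(A *v linear_flow A v t) \<bullet> u = (\<Sum>n. diffs c n * t ^ n)"
      unfolding linear_flow_def
      by (simp add: c_def diffs_def matrix_vector_mult_scaleR mult.commute del: of_nat_Suc)
    then show ?thesis
      using termdiffs_strong_converges_everywhere[OF inner_summable, of t]
      by (simp add: inner_flow)
  qed
  then have "(linear_flow A v has_vector_derivative A *v linear_flow A v t) (at t)"
    unfolding has_vector_derivative_def has_field_derivative_def
      has_derivative_componentwise_within[of "linear_flow A v"]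
    by (simp add: mult_commute_abs)
  then show ?thesis
    by (rule has_vector_derivative_at_within)
qed

section \<open>Backward Euler steps as averages of the flow\<close>

lemma one_minus_scaleR_matrix_vector_mult:
  fixes A :: "real ^ 'n ^ 'n"
  shows "(mat 1 - h *\<^sub>R A) *v y = y - h *\<^sub>R (A *v y)"
  by (simp add: matrix_vector_mult_diff_rdistrib scaleR_matrix_vector_assoc)

text \<open>A kernel vector \<open>v = h A v\<close> would satisfy \<open>\<parallel>v\<parallel> \<le> h \<parallel>A\<parallel> \<parallel>v\<parallel>\<close>, which forces \<open>v = 0\<close>.\<close>

lemma invertible_one_minus_scaleR:
  fixes A :: "real ^ 'n ^ 'n"
  assumes "h \<ge> 0" and "h * onorm ((*v) A) < 1"
  shows "invertible (mat 1 - h *\<^sub>R A)"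
proof -
  have "v = 0" if "(mat 1 - h *\<^sub>R A) *v v = 0" for v
  proof (rule ccontr)
    assume "v \<noteq> 0"
    have "norm v = h * norm (A *v v)"
      using that \<open>h \<ge> 0\<close>
      by (metis one_minus_scaleR_matrix_vector_mult abs_of_nonneg eq_iff_diff_eq_0 norm_scaleR)
    also have "\<dots> \<le> h * (onorm ((*v) A) * norm v)"
      by (intro mult_left_mono onorm matrix_vector_mul_bounded_linear \<open>h \<ge> 0\<close>)
    also have "\<dots> < 1 * norm v"
      using assms(2) \<open>v \<noteq> 0\<close> unfolding mult.assoc[symmetric]
      by (intro mult_strict_right_mono) auto
    finally show False by simp
  qed
  then show ?thesis
    unfolding invertible_left_inverse matrix_left_invertible_ker by blast
qed

text \<open>\<open>I - h A\<close> commutes with \<open>A\<close>, so it maps trajectories to trajectories. Working with this preimage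
  under the resolvent lets the invariance hypothesis be applied to it, not to \<open>y\<close>, whose
  starting point is not yet known to lie in the set.\<close>

lemma solves_linear_ode_resolvent_preimage:
  assumes "\<And>t. t \<ge> 0 \<Longrightarrow> (y has_vector_derivative A *v y t) (at t within {0..})"
  shows "solves_linear_ode A (\<lambda>t. y t - h *\<^sub>R (A *v y t))"
  unfolding solves_linear_ode_def
proof (intro allI impI)
  fix t :: real
  assume "t \<ge> 0"
  note y' = assms[OF this]
  have "((\<lambda>s. A *v y s) has_vector_derivative A *v (A *v y t)) (at t within {0..})"
    by (rule bounded_linear.has_vector_derivative[OF matrix_vector_mul_bounded_linear y'])
  then have "((\<lambda>s. y s - h *\<^sub>R (A *v y s)) has_vector_derivative
               A *v y t - h *\<^sub>R (A *v (A *v y t))) (at t within {0..})"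
    by (intro has_vector_derivative_diff y'
          bounded_linear.has_vector_derivative[OF bounded_linear_scaleR_right])
  then show "((\<lambda>s. y s - h *\<^sub>R (A *v y s)) has_vector_derivative
               A *v (y t - h *\<^sub>R (A *v y t))) (at t within {0..})"
    by (simp add: matrix_vector_mult_diff_distrib matrix_vector_mult_scaleR)
qed

text \<open>This is the integral representation of the resolvent in differential form: with \<open>y\<close> the
  trajectory through \<open>y\<^sub>0\<close>, the weight \<open>e\<^bsup>- t / h\<^esup>\<close> is the integrating factor that turns the
  inequality \<open>g \<bullet> (y - h y') \<le> \<beta>\<close> into monotonicity of \<open>e\<^bsup>- t / h\<^esup> (g \<bullet> y t - \<beta>)\<close>, and \<open>h \<parallel>A\<parallel> < 1\<close>
  lets the weight dominate the growth of \<open>y\<close>.\<close>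

lemma resolvent_in_halfspace:
  fixes A :: "real ^ 'n ^ 'n"
  assumes invariant: "invariant_continuous A S"
    and halfspace: "S \<subseteq> {x. g \<bullet> x \<le> \<beta>}"
    and h: "h > 0" "h * onorm ((*v) A) < 1"
    and start: "y\<^sub>0 - h *\<^sub>R (A *v y\<^sub>0) \<in> S"
  shows "g \<bullet> y\<^sub>0 \<le> \<beta>"
proof -
  define y where "y = linear_flow A y\<^sub>0"
  define w where "w t = exp (- t / h) * (g \<bullet> y t - \<beta>)" for t
  have y': "(y has_vector_derivative A *v y t) (at t within T)" for t T
    unfolding y_def by (rule linear_flow_has_vector_derivative)
  have "y 0 = y\<^sub>0" by (simp add: y_def)
  with start have preimage_in: "y t - h *\<^sub>R (A *v y t) \<in> S" if "t \<ge> 0" for t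
    using invariant[unfolded invariant_continuous_def, rule_format,
        OF solves_linear_ode_resolvent_preimage[where y = y and h = h, OF y']] that by simp

  have w_mono: "w 0 \<le> w t" if "t \<ge> 0" for t
  proof (rule DERIV_nonneg_imp_nondecreasing[OF that])
    fix s :: real
    assume "0 \<le> s"
    have gy': "((\<lambda>r. g \<bullet> y r) has_real_derivative g \<bullet> (A *v y s)) (at s)"
      unfolding has_real_derivative_iff_has_vector_derivative
      by (rule bounded_linear.has_vector_derivative[OF bounded_linear_inner_right y'])
    have w': "(w has_real_derivative
                 exp (- s / h) * ((\<beta> - g \<bullet> (y s - h *\<^sub>R (A *v y s))) / h)) (at s)"
      unfolding w_def using h(1)
      by (auto intro!: derivative_eq_intros gy' simp: inner_diff_right field_simps)
    have "g \<bullet> (y s - h *\<^sub>R (A *v y s)) \<le> \<beta>"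
      using preimage_in[OF \<open>0 \<le> s\<close>] halfspace by blast
    then have "0 \<le> exp (- s / h) * ((\<beta> - g \<bullet> (y s - h *\<^sub>R (A *v y s))) / h)"
      using h(1) by (intro mult_nonneg_nonneg divide_nonneg_pos) auto
    with w' show "\<exists>d. (w has_real_derivative d) (at s) \<and> 0 \<le> d"
      by blast
  qed

  have w_le: "w t \<le> norm g * norm y\<^sub>0 * exp (- (1 / h - onorm ((*v) A)) * t)
                      + \<bar>\<beta>\<bar> * exp (- (1 / h) * t)" if "t \<ge> 0" for t
  proof -
    have "g \<bullet> y t \<le> norm g * norm (y t)"
      by (rule norm_cauchy_schwarz)
    also have "\<dots> \<le> norm g * (exp (onorm ((*v) A) * t) * norm y\<^sub>0)"
      using norm_linear_flow_le[of A y\<^sub>0 t] that by (intro mult_left_mono) (auto simp: y_def)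
    finally have "w t \<le> exp (- t / h) * (norm g * (exp (onorm ((*v) A) * t) * norm y\<^sub>0) + \<bar>\<beta>\<bar>)"
      unfolding w_def by (intro mult_left_mono) auto
    also have "\<dots> = norm g * norm y\<^sub>0 * (exp (- t / h) * exp (onorm ((*v) A) * t))
                     + \<bar>\<beta>\<bar> * exp (- (1 / h) * t)"
      by (simp add: algebra_simps)
    also have "exp (- t / h) * exp (onorm ((*v) A) * t) = exp (- (1 / h - onorm ((*v) A)) * t)"
      by (simp add: exp_add[symmetric] algebra_simps)
    finally show ?thesis .
  qed

  have decay: "((\<lambda>t. exp (- c * t)) \<longlongrightarrow> 0) at_top" if "c > 0" for c :: real
    by (rule filterlim_compose[OF exp_at_bot])
       (use that in \<open>intro filterlim_tendsto_neg_mult_at_bot[OF tendsto_const] filterlim_ident, auto\<close>)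
  have "1 / h - onorm ((*v) A) > 0"
    using h by (simp add: field_simps)
  then have "((\<lambda>t. norm g * norm y\<^sub>0 * exp (- (1 / h - onorm ((*v) A)) * t)
                   + \<bar>\<beta>\<bar> * exp (- (1 / h) * t)) \<longlongrightarrow> norm g * norm y\<^sub>0 * 0 + \<bar>\<beta>\<bar> * 0) at_top"
    using h(1) by (intro tendsto_intros decay) auto
  moreover have "\<forall>\<^sub>F t in at_top. w 0 \<le> norm g * norm y\<^sub>0 * exp (- (1 / h - onorm ((*v) A)) * t)
                   + \<bar>\<beta>\<bar> * exp (- (1 / h) * t)"
    using eventually_ge_at_top[of 0]
    by eventually_elim (use w_mono w_le order_trans in blast)
  ultimately have "w 0 \<le> norm g * norm y\<^sub>0 * 0 + \<bar>\<beta>\<bar> * 0"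
    by (intro tendsto_lowerbound) auto
  then show ?thesis
    by (simp add: w_def \<open>y 0 = y\<^sub>0\<close>)
qed

section \<open>Polyhedra\<close>

lemma mem_polyhedron_of_iff: "x \<in> polyhedron_of G b \<longleftrightarrow> (\<forall>i. G $ i \<bullet> x \<le> b $ i)"
  by (simp add: polyhedron_of_def less_eq_vec_def matrix_vector_mul_component)

lemma resolvent_in_polyhedron:
  fixes A :: "real ^ 'n ^ 'n"
  assumes "invariant_continuous A (polyhedron_of G b)"
    and "h \<ge> 0" "h * onorm ((*v) A) < 1"
    and "y - h *\<^sub>R (A *v y) \<in> polyhedron_of G b"
  shows "y \<in> polyhedron_of G b"
proof (cases "h = 0")
  case True
  then show ?thesis using assms(4) by simp
next
  case False
  have "G $ i \<bullet> y \<le> b $ i" for i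
    using False assms(2-4)
    by (intro resolvent_in_halfspace[OF assms(1)]) (auto simp: mem_polyhedron_of_iff)
  then show ?thesis by (simp add: mem_polyhedron_of_iff)
qed

theorem theorem4p3:
  fixes A :: "real ^ 'n ^ 'n"
    and G :: "real ^ 'n ^ 'm"
    and b :: "real ^ 'm"
  assumes "invariant_continuous A (polyhedron_of G b)"
  shows "\<exists>\<tau>>0. \<forall>\<Delta>t\<in>{0..\<tau>}.
           invertible (mat 1 - \<Delta>t *\<^sub>R A) \<and>
           (\<forall>x\<in>polyhedron_of G b. matrix_inv (mat 1 - \<Delta>t *\<^sub>R A) *v x \<in> polyhedron_of G b) \<and>
           invariant_discrete (matrix_inv (mat 1 - \<Delta>t *\<^sub>R A)) (polyhedron_of G b)"
proof -
  \<comment> \<open>The summand 1 covers \<open>A = 0\<close> and makes \<open>\<tau> \<parallel>A\<parallel> < 1\<close> strict.\<close>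
  define \<tau> where "\<tau> = 1 / (onorm ((*v) A) + 1)"
  have onorm_nonneg: "onorm ((*v) A) \<ge> 0"
    by (intro onorm_pos_le matrix_vector_mul_bounded_linear)
  then have "\<tau> > 0"
    by (simp add: \<tau>_def)
  moreover have "invertible (mat 1 - h *\<^sub>R A) \<and>
      (\<forall>x\<in>polyhedron_of G b. matrix_inv (mat 1 - h *\<^sub>R A) *v x \<in> polyhedron_of G b) \<and>
      invariant_discrete (matrix_inv (mat 1 - h *\<^sub>R A)) (polyhedron_of G b)"
    if "h \<in> {0..\<tau>}" for h
  proof -
    have "h \<ge> 0" using that by simp
    have "h * onorm ((*v) A) \<le> \<tau> * onorm ((*v) A)"
      using that onorm_nonneg by (intro mult_right_mono) auto
    also have "\<dots> < 1"
      using onorm_nonneg by (simp add: \<tau>_def)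
    finally have small: "h * onorm ((*v) A) < 1" .
    have inv: "invertible (mat 1 - h *\<^sub>R A)"
      by (rule invertible_one_minus_scaleR[OF \<open>h \<ge> 0\<close> small])
    have step: "matrix_inv (mat 1 - h *\<^sub>R A) *v x \<in> polyhedron_of G b"
      if "x \<in> polyhedron_of G b" for x
    proof (rule resolvent_in_polyhedron[OF assms \<open>h \<ge> 0\<close> small])
      have "(mat 1 - h *\<^sub>R A) *v (matrix_inv (mat 1 - h *\<^sub>R A) *v x) = x"
        using someI_ex[OF inv[unfolded invertible_def]]
        by (simp add: matrix_vector_mul_assoc matrix_inv_def)
      then show "matrix_inv (mat 1 - h *\<^sub>R A) *v x
                   - h *\<^sub>R (A *v (matrix_inv (mat 1 - h *\<^sub>R A) *v x)) \<in> polyhedron_of G b"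
        using that by (simp add: one_minus_scaleR_matrix_vector_mult)
    qed
    show ?thesis
      using inv step by (simp add: invariant_discrete_def)
  qed
  ultimately show ?thesis by blast
qed

end
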